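(* Let $p\in[1,\infty)$, let $\mu,\nu\in P_p(\mathbb{R})$ be two probability measures, and let $F$ and $G$ be the distribution functions of $\mu$ and $\nu$, respectively. Then $$W_p^p(\mu,\nu)=\int_{-\infty}^{\infty}\int_{-\infty}^{\infty}|x-y|^p\,dM(F(x),G(y))=\int_0^1|F^{-1}(u)-G^{-1}(u)|^p\,du,$$ where $M(a,b)=\min\{a,b\}$ and $F^{-1}(u)=\inf\{x\in\mathbb{R}: F(x)\ge u\}$, $G^{-1}(u)=\inf\{x\in\mathbb{R}: G(x)\ge u\}$ for $u\in[0,1]$, with the convention $\inf\emptyset=\infty$.
   Context: $P_p(\mathbb{R})$ is the set of Borel probability measures on $\mathbb{R}$ with finite $p$-th absolute moment. The Wasserstein distance of order $p$ is defined by $W_p^p(\mu,\nu)=\inf_{\pi\in\Pi(\mu,\nu)}\int_{\mathbb{R}\times\mathbb{R}}|x-y|^p\,\pi(dx,dy)$, where $\Pi(\mu,\nu)$ is the set of all couplings, i.e. Borel probability measures on $\mathbb{R}\times\mathbb{R}$ with first marginal $\mu$ and second marginal $\nu$. Distribution functions are right-continuous: $F(x)=\mu((-\infty,x])$, $G(y)=\nu((-\infty,y])$. $M:[0,1]^2\to[0,1]$, $M(a,b)=\min\{a,b\}$, is the (two-dimensional) comonotonicity copula. The notation $dM(F(x),G(y))$ denotes integration with respect to the Borel probability measure on $\mathbb{R}^2$ whose joint distribution function is $(x,y)\mapsto\min\{F(x),G(y)\}$. *)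

theory Defs
  imports "HOL-Probability.Probability"
begin

definition wasserstein_space :: "real \<Rightarrow> real measure set" where
  "wasserstein_space p = {\<mu>. real_distribution \<mu> \<and> integrable \<mu> (\<lambda>x. \<bar>x\<bar> powr p)}"

definition couplings :: "real measure \<Rightarrow> real measure \<Rightarrow> (real \<times> real) measure set" where
  "couplings \<mu> \<nu> =
     {\<pi>. prob_space \<pi> \<and> sets \<pi> = sets borel \<and>
         distr \<pi> borel fst = \<mu> \<and> distr \<pi> borel snd = \<nu>}"

text \<open>
  The infimum is taken in the extended nonnegative reals, so that every coupling has a
  well-defined cost. For measures with finite \<open>p\<close>-th absolute moments all costs are finite,
  so the conversion to a real number loses nothing.
\<close>

definition wasserstein_dist :: "real \<Rightarrow> real measure \<Rightarrow> real measure \<Rightarrow> real" where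
  "wasserstein_dist p \<mu> \<nu> =
     enn2real (INF \<pi>\<in>couplings \<mu> \<nu>. \<integral>\<^sup>+ (x, y). ennreal (\<bar>x - y\<bar> powr p) \<partial>\<pi>) powr (1 / p)"

text \<open>Only the values for \<open>a, b \<in> [0, 1]\<close> matter.\<close>

definition comonotonicity_copula :: "real \<Rightarrow> real \<Rightarrow> real" where
  "comonotonicity_copula a b = min a b"

text \<open>
  The measure \<open>dH\<close> for a joint distribution function \<open>H\<close> on the plane. A Borel probability
  measure is determined by its joint distribution function, but the description says nothing
  about the result when \<open>H\<close> is not a joint distribution function.
\<close>

definition joint_cdf_measure :: "(real \<Rightarrow> real \<Rightarrow> real) \<Rightarrow> (real \<times> real) measure" where
  "joint_cdf_measure H =
     (THE \<gamma>. prob_space \<gamma> \<and> sets \<gamma> = sets borel \<and>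
          (\<forall>x y. measure \<gamma> ({..x} \<times> {..y}) = H x y))"

text \<open>
  The values are extended reals: the infimum of the empty set is \<open>\<infinity>\<close>, and for a distribution
  function \<open>F\<close> the value at \<open>0\<close> is \<open>-\<infinity>\<close>.
\<close>

definition quantile :: "(real \<Rightarrow> real) \<Rightarrow> real \<Rightarrow> ereal" where
  "quantile F u = Inf (ereal ` {x. F x \<ge> u})"

text \<open>Real powers on \<open>[0, \<infinity>]\<close>, meant for positive exponents.\<close>

definition ennreal_powr :: "ennreal \<Rightarrow> real \<Rightarrow> ennreal" where
  "ennreal_powr x p = (if x = \<infinity> then \<infinity> else ennreal (enn2real x powr p))"

end

theory Submission
  imports Defs
begin

text \<open>
  For \<open>p > 1\<close> the cost \<open>\<bar>x - y\<bar> powr p\<close> is a mixture over \<open>a > 0\<close> of the costs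
  \<open>max 0 (\<bar>x - y\<bar> - a)\<close>, and for \<open>p = 1\<close> it is the one with \<open>a = 0\<close>. The integral of such a cost
  against \<open>\<pi>\<close> is the integral over \<open>s\<close> of the \<open>\<pi>\<close>-masses of the quadrants \<open>x \<le> s, s + a < y\<close> and
  \<open>y \<le> s, s + a < x\<close>. Every coupling gives the quadrant \<open>x \<le> s, t < y\<close> mass at least
  \<open>F s - G t\<close>, and the comonotone coupling, the law of the pair of quantile functions under the
  uniform distribution on \<open>(0, 1)\<close>, gives it exactly the positive part of that. So the comonotone
  coupling is optimal for all these costs at once.
\<close>

section \<open>Laws on the plane and their joint distribution functions\<close>

text \<open>Lower quadrants are the down-sets \<open>{..a}\<close> of the componentwise order. They
  generate the Borel sets and are closed under intersection, so a pi-system argument applies. This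
  supplies the uniqueness that the \<open>THE\<close> in \<open>joint_cdf_measure\<close>
  requires.\<close>

lemma prob_space_prod_borel_eqI:
  fixes M N :: "(real \<times> real) measure"
  assumes "prob_space M" "prob_space N" "sets M = sets borel" "sets N = sets borel"
    and eq: "\<And>x y. measure M ({..x} \<times> {..y}) = measure N ({..x} \<times> {..y})"
  shows "M = N"
proof -
  interpret M: prob_space M by fact
  interpret N: prob_space N by fact
  let ?E = "range (\<lambda>a::real \<times> real. {..a})"
  have gen: "sets borel = sigma_sets UNIV ?E"
    by (simp add: borel_eq_atMost)
  have quadrant: "{..a} = {..fst a} \<times> {..snd a}" for a :: "real \<times> real"
    by (auto simp: less_eq_prod_def)
  show ?thesis
  proof (rule measure_eqI_generator_eq[where A = "\<lambda>n. {..(real n, real n)}" and E = ?E and \<Omega> = UNIV])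
    show "Int_stable ?E"
      unfolding Int_stable_def
    proof safe
      fix a b :: "real \<times> real"
      have "{..a} \<inter> {..b} = {..inf a b}" by auto
      then show "{..a} \<inter> {..b} \<in> ?E" by auto
    qed
    show "(\<Union>n. {..(real n, real n)}) = UNIV"
    proof (intro equalityI subset_UNIV subsetI)
      fix z :: "real \<times> real"
      obtain n where "max (fst z) (snd z) \<le> real n"
        using real_arch_simple by blast
      then show "z \<in> (\<Union>n. {..(real n, real n)})"
        by (auto simp: less_eq_prod_def)
    qed
    show "emeasure M X = emeasure N X" if "X \<in> ?E" for X
      using that eq by (auto simp: quadrant M.emeasure_eq_measure N.emeasure_eq_measure)
  qed (auto simp: assms(3,4) gen M.emeasure_eq_measure)
qed

section \<open>Powers of the distance as integrals of quadrant masses\<close>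

lemma powr_eq_nn_integral_excess:
  fixes p d :: real
  assumes "p > 1" "d \<ge> 0"
  shows "ennreal (d powr p) =
    (\<integral>\<^sup>+ a\<in>{0<..}. ennreal (p * (p - 1) * a powr (p - 2)) * ennreal (d - a) \<partial>lborel)"
  \<comment> \<open>\<^const>\<open>ennreal\<close> truncates, so \<open>ennreal (d - a)\<close> is the positive part of \<open>d - a\<close>.\<close>
proof (cases "d = 0")
  case True
  have "(\<integral>\<^sup>+ a\<in>{0<..}. ennreal (p * (p - 1) * a powr (p - 2)) * ennreal (d - a) \<partial>lborel) =
      (\<integral>\<^sup>+ a. 0 \<partial>(lborel :: real measure))"
    by (intro nn_integral_cong) (auto simp: True ennreal_neg split: split_indicator)
  with True assms show ?thesis by simp
next
  case False
  define f where "f a = p * (p - 1) * a powr (p - 2) * (d - a)" for a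
  \<comment> \<open>The weight in \<open>f\<close> is the second derivative of
    \<open>a powr p\<close>, so the claim is Taylor's formula at 0 with integral remainder.
    Integrating \<open>f\<close> by parts gives
    \<open>p * a powr (p - 1) * (d - a) + a powr p\<close>, which regroups to
    \<open>H\<close>.\<close>
  define H where "H a = p * d * a powr (p - 1) - (p - 1) * a powr p" for a
  \<comment> \<open>For \<open>p < 2\<close> the integrand is unbounded near 0, hence a fundamental
    theorem that takes one-sided limits at the endpoints. \<open>H\<close> still tends to 0 there
    because \<open>p - 1 > 0\<close>.\<close>
  have *: "((H \<circ> real_of_ereal) \<longlongrightarrow> 0) (at_right (ereal 0))"
    "((H \<circ> real_of_ereal) \<longlongrightarrow> d powr p) (at_left (ereal d))"
    unfolding ereal_tendsto_simps
  proof -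
    show "(H \<longlongrightarrow> 0) (at_right 0)"
    proof -
      have "(H \<longlongrightarrow> H 0) (at_right 0)"
        unfolding H_def using assms
        by (intro tendsto_intros) (auto intro!: eventually_at_right_less[THEN eventually_mono])
      then show ?thesis using assms by (simp add: H_def)
    qed
    have "(H \<longlongrightarrow> H d) (at_left d)"
      unfolding H_def using False by (intro tendsto_intros) auto
    moreover have "H d = d powr p"
      using assms False by (simp add: H_def powr_diff algebra_simps)
    ultimately show "(H \<longlongrightarrow> d powr p) (at_left d)" by simp
  qed
  have der: "DERIV H a :> f a" if "ereal 0 < ereal a" "ereal a < ereal d" for a
  proof -
    have a: "a > 0" using that by simp
    have "DERIV H a :> p * d * ((p - 1) * a powr (p - 1 - 1)) - (p - 1) * (p * a powr (p - 1))"
      unfolding H_def by (intro DERIV_diff DERIV_cmult has_real_derivative_powr a)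
    moreover have "a powr (p - 1) = a * a powr (p - 2)"
      using a powr_mult_base[of a "p - 2"] by (simp add: algebra_simps)
    ultimately show ?thesis by (simp add: f_def algebra_simps)
  qed
  have cont: "isCont f a" if "ereal 0 < ereal a" "ereal a < ereal d" for a
    unfolding f_def using that by (intro continuous_intros) auto
  have nonneg: "AE a in lborel. ereal 0 < ereal a \<longrightarrow> ereal a < ereal d \<longrightarrow> 0 \<le> f a"
    using assms by (auto simp: f_def)
  have lt: "ereal 0 < ereal d" using assms False by simp
  note FTC = interval_integral_FTC_nonneg[OF lt der cont nonneg *]
  have ein: "einterval (ereal 0) (ereal d) = {0<..<d}" by (auto simp: einterval_def)
  have "ennreal (d powr p) = ennreal (LBINT a:{0<..<d}. f a)"
    using FTC(2) assms by (simp add: interval_lebesgue_integral_def ein)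
  also have "\<dots> = (\<integral>\<^sup>+ a. ennreal (indicator {0<..<d} a *\<^sub>R f a) \<partial>lborel)"
    using FTC(1) assms unfolding set_lebesgue_integral_def set_integrable_def ein
    by (intro nn_integral_eq_integral[symmetric]) (auto simp: f_def split: split_indicator)
  also have "\<dots> = (\<integral>\<^sup>+ a\<in>{0<..}. ennreal (p * (p - 1) * a powr (p - 2)) * ennreal (d - a) \<partial>lborel)"
  proof (intro nn_integral_cong)
    fix a :: real
    show "ennreal (indicator {0<..<d} a *\<^sub>R f a) =
        ennreal (p * (p - 1) * a powr (p - 2)) * ennreal (d - a) * indicator {0<..} a"
    proof (cases "0 < a \<and> a < d")
      case True
      then show ?thesis using assms by (simp add: f_def ennreal_mult del: ennreal_mult')
    next
      case False
      then show ?thesis by (auto simp: ennreal_neg split: split_indicator)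
    qed
  qed
  finally show ?thesis .
qed

text \<open>The point \<open>(x, y)\<close> lies in \<open>{..s} \<times> {s + a<..}\<close> exactly
  for \<open>s\<close> in \<open>{x..<y - a}\<close>, and in the mirrored quadrant exactly for
  \<open>s\<close> in \<open>{y..<x - a}\<close>. Since \<open>a \<ge> 0\<close>, at most one of
  these intervals is nonempty, and its length is the excess.\<close>

lemma ennreal_excess_eq_nn_integral:
  fixes x y a :: real
  assumes "a \<ge> 0"
  shows "ennreal (\<bar>x - y\<bar> - a) =
    (\<integral>\<^sup>+ s. indicator ({..s} \<times> {s + a<..}) (x, y) + indicator ({s + a<..} \<times> {..s}) (x, y) \<partial>lborel)"
proof -
  have Ico: "emeasure lborel {l..<r} = ennreal (r - l)" for l r :: real
    by (cases "l \<le> r") (auto simp: ennreal_neg)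
  have "(\<integral>\<^sup>+ s. indicator ({..s} \<times> {s + a<..}) (x, y) + indicator ({s + a<..} \<times> {..s}) (x, y) \<partial>lborel)
    = (\<integral>\<^sup>+ s. indicator {x..<y - a} s + indicator {y..<x - a} s \<partial>lborel)"
    by (intro nn_integral_cong) (auto simp: indicator_def)
  also have "\<dots> = emeasure lborel {x..<y - a} + emeasure lborel {y..<x - a}"
    by (subst nn_integral_add) auto
  also have "\<dots> = ennreal (\<bar>x - y\<bar> - a)"
    using assms by (auto simp: Ico abs_if ennreal_neg algebra_simps)
  finally show ?thesis by simp
qed

text \<open>Tonelli's theorem applied to the pointwise formula. The cost now depends on
  \<open>\<pi>\<close> only through the masses of off-diagonal quadrants.\<close>

lemma nn_integral_excess:
  fixes \<pi> :: "(real \<times> real) measure"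
  assumes "prob_space \<pi>" and sets [measurable_cong]: "sets \<pi> = sets borel" and "a \<ge> 0"
  shows "(\<integral>\<^sup>+ (x, y). ennreal (\<bar>x - y\<bar> - a) \<partial>\<pi>) =
    (\<integral>\<^sup>+ s. emeasure \<pi> ({..s} \<times> {s + a<..}) + emeasure \<pi> ({s + a<..} \<times> {..s}) \<partial>lborel)"
proof -
  interpret prob_space \<pi> by fact
  interpret pair_sigma_finite \<pi> "lborel :: real measure" ..
  have [measurable]: "{..s} \<times> {s + a<..} \<in> sets \<pi>" "{s + a<..} \<times> {..s} \<in> sets \<pi>" for s
    unfolding sets by (simp_all flip: borel_prod)
  have [measurable]: "(fst :: real \<times> real \<Rightarrow> real) \<in> borel_measurable \<pi>"
     "(snd :: real \<times> real \<Rightarrow> real) \<in> borel_measurable \<pi>"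
    unfolding measurable_cong_sets[OF sets refl] by (simp_all flip: borel_prod)
  have "(\<integral>\<^sup>+ (x, y). ennreal (\<bar>x - y\<bar> - a) \<partial>\<pi>) =
     (\<integral>\<^sup>+ z. \<integral>\<^sup>+ s. indicator ({..s} \<times> {s + a<..}) z + indicator ({s + a<..} \<times> {..s}) z \<partial>lborel \<partial>\<pi>)"
    by (intro nn_integral_cong) (simp add: ennreal_excess_eq_nn_integral[OF \<open>a \<ge> 0\<close>] split_beta)
  \<comment> \<open>The quadrants move with \<open>s\<close>, so their indicators are unfolded into
    inequalities to obtain measurability jointly in \<open>s\<close> and \<open>z\<close>.\<close>
  also have "\<dots> = (\<integral>\<^sup>+ s. \<integral>\<^sup>+ z. indicator ({..s} \<times> {s + a<..}) z + indicator ({s + a<..} \<times> {..s}) z \<partial>\<pi> \<partial>lborel)"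
    by (intro Fubini'[symmetric])
      (unfold split_beta' indicator_def of_bool_def mem_Times_iff atMost_iff greaterThan_iff, measurable)
  also have "\<dots> = (\<integral>\<^sup>+ s. emeasure \<pi> ({..s} \<times> {s + a<..}) + emeasure \<pi> ({s + a<..} \<times> {..s}) \<partial>lborel)"
    by (intro nn_integral_cong, subst nn_integral_add) auto
  finally show ?thesis .
qed

text \<open>Both costs are the same nonnegative mixture of quadrant masses, so domination on
  quadrants carries over to the costs.\<close>

lemma nn_integral_powr_mono:
  fixes \<pi> \<gamma> :: "(real \<times> real) measure"
  assumes "prob_space \<pi>" "sets \<pi> = sets borel" "prob_space \<gamma>" "sets \<gamma> = sets borel" and "p \<ge> 1"
    and le: "\<And>s t. emeasure \<gamma> ({..s} \<times> {t<..}) \<le> emeasure \<pi> ({..s} \<times> {t<..})"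
      "\<And>s t. emeasure \<gamma> ({t<..} \<times> {..s}) \<le> emeasure \<pi> ({t<..} \<times> {..s})"
  shows "(\<integral>\<^sup>+ (x, y). ennreal (\<bar>x - y\<bar> powr p) \<partial>\<gamma>) \<le> (\<integral>\<^sup>+ (x, y). ennreal (\<bar>x - y\<bar> powr p) \<partial>\<pi>)"
proof -
  have excess: "(\<integral>\<^sup>+ (x, y). ennreal (\<bar>x - y\<bar> - a) \<partial>\<gamma>) \<le> (\<integral>\<^sup>+ (x, y). ennreal (\<bar>x - y\<bar> - a) \<partial>\<pi>)"
    if "a \<ge> 0" for a
    using that assms by (auto simp: nn_integral_excess intro!: nn_integral_mono add_mono)
  show ?thesis
  \<comment> \<open>The weight \<open>p * (p - 1) * a powr (p - 2)\<close> vanishes at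
    \<open>p = 1\<close>, so that case uses the excess with \<open>a = 0\<close> directly.\<close>
  proof (cases "p = 1")
    case True
    then show ?thesis using excess[of 0] by simp
  next
    case False
    let ?k = "\<lambda>a::real. ennreal (p * (p - 1) * a powr (p - 2)) * indicator {0<..} a"
    have mixture: "(\<integral>\<^sup>+ (x, y). ennreal (\<bar>x - y\<bar> powr p) \<partial>\<rho>) =
        (\<integral>\<^sup>+ a. ?k a * (\<integral>\<^sup>+ (x, y). ennreal (\<bar>x - y\<bar> - a) \<partial>\<rho>) \<partial>lborel)"
      if "prob_space \<rho>" and sets [measurable_cong]: "sets \<rho> = sets borel" for \<rho> :: "(real \<times> real) measure"
    proof -
      interpret prob_space \<rho> by fact
      interpret pair_sigma_finite \<rho> "lborel :: real measure" ..
      have [measurable]: "(fst :: real \<times> real \<Rightarrow> real) \<in> borel_measurable \<rho>"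
         "(snd :: real \<times> real \<Rightarrow> real) \<in> borel_measurable \<rho>"
        unfolding measurable_cong_sets[OF sets refl] by (simp_all flip: borel_prod)
      have "(\<integral>\<^sup>+ (x, y). ennreal (\<bar>x - y\<bar> powr p) \<partial>\<rho>) =
          (\<integral>\<^sup>+ z. \<integral>\<^sup>+ a. ?k a * ennreal (\<bar>fst z - snd z\<bar> - a) \<partial>lborel \<partial>\<rho>)"
        using assms False
        by (intro nn_integral_cong) (simp add: split_beta powr_eq_nn_integral_excess mult_ac)
      also have "\<dots> = (\<integral>\<^sup>+ a. \<integral>\<^sup>+ z. ?k a * ennreal (\<bar>fst z - snd z\<bar> - a) \<partial>\<rho> \<partial>lborel)"
        by (intro Fubini'[symmetric]) measurable
      also have "\<dots> = (\<integral>\<^sup>+ a. ?k a * (\<integral>\<^sup>+ (x, y). ennreal (\<bar>x - y\<bar> - a) \<partial>\<rho>) \<partial>lborel)"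
        by (intro nn_integral_cong) (simp add: nn_integral_cmult split_beta')
      finally show ?thesis .
    qed
    show ?thesis
      unfolding mixture[OF assms(1,2)] mixture[OF assms(3,4)]
      by (intro nn_integral_mono) (auto intro!: mult_left_mono excess split: split_indicator)
  qed
qed

section \<open>The comonotone coupling and its quadrant masses\<close>

text \<open>For \<open>r = 1\<close> the set may miss the endpoint 1 of \<open>{l<..r}\<close>,
  which is null. For \<open>r < l\<close> it is empty and \<open>ennreal\<close> truncates to 0; the
  positive parts in the quadrant masses arise this way.\<close>

lemma emeasure_lborel_unit_Ioc:
  fixes l r :: real
  assumes "0 \<le> l" "r \<le> 1"
  shows "emeasure lborel {u \<in> {0<..<1}. l < u \<and> u \<le> r} = ennreal (r - l)"
proof -
  have "emeasure lborel {l<..r} = ennreal (r - l)"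
    by (cases "l \<le> r") (auto simp: ennreal_neg)
  moreover have "emeasure lborel {u \<in> {0<..<1}. l < u \<and> u \<le> r} = emeasure lborel {l<..r}"
    using assms AE_lborel_singleton[of "1::real"]
    by (intro emeasure_eq_AE) (auto elim!: eventually_mono)
  ultimately show ?thesis by simp
qed

text \<open>Here \<open>M.C\<close> is the distribution function of \<open>M\<close> and
  \<open>M.I\<close> its real-valued generalized inverse. Working on the open unit interval avoids
  the endpoints, where quantiles may be infinite.\<close>

locale cdf_distribution_pair =
  M: cdf_distribution M + N: cdf_distribution N for M N :: "real measure"
begin

abbreviation \<Omega> :: "real measure" where
  "\<Omega> \<equiv> restrict_space lborel {0<..<1}"

definition comonotone :: "(real \<times> real) measure" where
  "comonotone = distr \<Omega> borel (\<lambda>u. (M.I u, N.I u))"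

lemma prob_space_unit: "prob_space \<Omega>"
  by (auto simp: emeasure_restrict_space space_restrict_space intro!: prob_spaceI)

lemma measurable_I [measurable]: "M.I \<in> borel_measurable \<Omega>" "N.I \<in> borel_measurable \<Omega>"
  using M.measurable_CI N.measurable_CI
  by (simp_all cong: measurable_cong_sets add: sets_restrict_space)

lemma sets_comonotone [simp, measurable_cong]: "sets comonotone = sets borel"
  by (simp add: comonotone_def)

lemma measurable_I_pair [measurable]: "(\<lambda>u. (M.I u, N.I u)) \<in> borel_measurable \<Omega>"
  unfolding borel_prod[symmetric] by measurable

lemma prob_space_comonotone: "prob_space comonotone"
  unfolding comonotone_def by (intro prob_space.prob_space_distr prob_space_unit measurable_I_pair)

text \<open>Each marginal is the law of a quantile function under the uniform distribution, which is
  the given measure by \<open>distr_I_eq_M\<close>.\<close>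

lemma comonotone_in_couplings: "comonotone \<in> couplings M N"
proof -
  have fs: "fst \<in> borel_measurable (borel :: (real \<times> real) measure)" "snd \<in> borel_measurable (borel :: (real \<times> real) measure)"
    by (simp_all flip: borel_prod)
  have "distr comonotone borel fst = M" "distr comonotone borel snd = N"
    unfolding comonotone_def using M.distr_I_eq_M N.distr_I_eq_M
    by (simp_all add: distr_distr[OF fs(1)] distr_distr[OF fs(2)] comp_def)
  then show ?thesis
    by (simp add: couplings_def prob_space_comonotone)
qed

lemma emeasure_comonotone:
  assumes "A \<in> sets borel"
  shows "emeasure comonotone A = emeasure lborel {u \<in> {0<..<1}. (M.I u, N.I u) \<in> A}"
proof -
  have "emeasure comonotone A = emeasure \<Omega> ((\<lambda>u. (M.I u, N.I u)) -` A \<inter> space \<Omega>)"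
    unfolding comonotone_def by (intro emeasure_distr measurable_I_pair assms)
  also have "\<dots> = emeasure lborel ((\<lambda>u. (M.I u, N.I u)) -` A \<inter> {0<..<1})"
    by (subst emeasure_restrict_space) (auto simp: space_restrict_space)
  finally show ?thesis
    by (simp add: vimage_def Int_def conj_commute)
qed

text \<open>The Galois connection \<open>M.I u \<le> x \<longleftrightarrow> u \<le> M.C x\<close>
  turns each quadrant into an interval of \<open>u\<close>, whose length is the mass.\<close>

lemma emeasure_comonotone_quadrants:
  "emeasure comonotone ({..x} \<times> {..y}) = ennreal (min (M.C x) (N.C y))"
  "emeasure comonotone ({..x} \<times> {y<..}) = ennreal (M.C x - N.C y)"
  "emeasure comonotone ({x<..} \<times> {..y}) = ennreal (N.C y - M.C x)"
proof -
  have borel: "{..x} \<times> {..y} \<in> sets borel" "{..x} \<times> {y<..} \<in> sets borel" "{x<..} \<times> {..y} \<in> sets borel"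
    by (auto intro!: borel_Times)
  have ends: "0 \<le> M.C x" "0 \<le> N.C y" "M.C x \<le> 1" "N.C y \<le> 1"
    by (simp_all add: M.cdf_nonneg N.cdf_nonneg M.cdf_bounded_prob N.cdf_bounded_prob)
  have I_le: "M.I u \<le> x \<longleftrightarrow> u \<le> M.C x" "x < M.I u \<longleftrightarrow> M.C x < u"
      "N.I u \<le> y \<longleftrightarrow> u \<le> N.C y" "y < N.I u \<longleftrightarrow> N.C y < u" if "0 < u" "u < 1" for u
    using M.pseudoinverse[OF that] N.pseudoinverse[OF that] by (metis not_le)+
  have "{u \<in> {0<..<1}. (M.I u, N.I u) \<in> {..x} \<times> {..y}} = {u \<in> {0<..<1}. 0 < u \<and> u \<le> min (M.C x) (N.C y)}"
    using I_le by auto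
  then show "emeasure comonotone ({..x} \<times> {..y}) = ennreal (min (M.C x) (N.C y))"
    using emeasure_lborel_unit_Ioc[of 0 "min (M.C x) (N.C y)"] ends by (simp add: emeasure_comonotone[OF borel(1)])
  have "{u \<in> {0<..<1}. (M.I u, N.I u) \<in> {..x} \<times> {y<..}} = {u \<in> {0<..<1}. N.C y < u \<and> u \<le> M.C x}"
    using I_le by auto
  then show "emeasure comonotone ({..x} \<times> {y<..}) = ennreal (M.C x - N.C y)"
    using emeasure_lborel_unit_Ioc[of "N.C y" "M.C x"] ends by (simp add: emeasure_comonotone[OF borel(2)])
  have "{u \<in> {0<..<1}. (M.I u, N.I u) \<in> {x<..} \<times> {..y}} = {u \<in> {0<..<1}. M.C x < u \<and> u \<le> N.C y}"
    using I_le by auto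
  then show "emeasure comonotone ({x<..} \<times> {..y}) = ennreal (N.C y - M.C x)"
    using emeasure_lborel_unit_Ioc[of "M.C x" "N.C y"] ends by (simp add: emeasure_comonotone[OF borel(3)])
qed

text \<open>The first quadrant formula shows that \<open>comonotone\<close> has the required joint
  distribution function, and lower quadrants determine the measure, so the definite description
  picks it.\<close>

lemma joint_cdf_measure_comonotone:
  "joint_cdf_measure (\<lambda>x y. comonotonicity_copula (M.C x) (N.C y)) = comonotone"
proof -
  have "measure comonotone ({..x} \<times> {..y}) = min (M.C x) (N.C y)" for x y
    by (simp add: measure_def emeasure_comonotone_quadrants M.cdf_nonneg N.cdf_nonneg)
  then show ?thesis
    unfolding joint_cdf_measure_def comonotonicity_copula_def
    by (intro the_equality prob_space_prod_borel_eqI) (auto simp: prob_space_comonotone)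
qed

section \<open>Optimality among all couplings\<close>

lemma emeasure_comonotone_le_coupling:
  assumes "\<pi> \<in> couplings M N"
  shows "emeasure comonotone ({..s} \<times> {t<..}) \<le> emeasure \<pi> ({..s} \<times> {t<..})"
    and "emeasure comonotone ({t<..} \<times> {..s}) \<le> emeasure \<pi> ({t<..} \<times> {..s})"
proof -
  have "prob_space \<pi>" and sets [measurable_cong]: "sets \<pi> = sets borel"
    and marginal: "M = distr \<pi> borel fst" "N = distr \<pi> borel snd"
    using assms by (auto simp: couplings_def)
  interpret \<pi>: prob_space \<pi> by fact
  have space: "space \<pi> = UNIV"
    using sets_eq_imp_space_eq[OF sets] by simp
  have [measurable]: "(fst :: real \<times> real \<Rightarrow> real) \<in> borel_measurable \<pi>"
      "(snd :: real \<times> real \<Rightarrow> real) \<in> borel_measurable \<pi>"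
    unfolding measurable_cong_sets[OF sets refl] by (simp_all flip: borel_prod)
  have [simp]: "A \<times> B \<in> sets \<pi>" if "A \<in> sets borel" "B \<in> sets borel" for A B :: "real set"
    unfolding sets using that by (simp flip: borel_prod)
  have M: "M.C x = measure \<pi> ({..x} \<times> UNIV)" for x
    by (subst marginal, subst cdf_def, subst measure_distr) (auto simp: space intro!: arg_cong[where f="measure \<pi>"])
  have N: "N.C x = measure \<pi> (UNIV \<times> {..x})" for x
    by (subst marginal, subst cdf_def, subst measure_distr) (auto simp: space intro!: arg_cong[where f="measure \<pi>"])
  \<comment> \<open>The half-plane \<open>x \<le> s\<close> is covered by the quadrant and the
    half-plane \<open>y \<le> t\<close>. The union bound gives \<open>M.C s - N.C t\<close> as a
    lower bound, and truncating it at 0 is harmless since masses are nonnegative.\<close>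
  have "M.C s \<le> measure \<pi> ({..s} \<times> {t<..} \<union> UNIV \<times> {..t})"
    unfolding M by (intro \<pi>.finite_measure_mono) auto
  also have "\<dots> \<le> measure \<pi> ({..s} \<times> {t<..}) + N.C t"
    unfolding N by (intro measure_Un_le) auto
  finally show "emeasure comonotone ({..s} \<times> {t<..}) \<le> emeasure \<pi> ({..s} \<times> {t<..})"
    by (simp add: emeasure_comonotone_quadrants \<pi>.emeasure_eq_measure)
  have "N.C s \<le> measure \<pi> ({t<..} \<times> {..s} \<union> {..t} \<times> UNIV)"
    unfolding N by (intro \<pi>.finite_measure_mono) auto
  also have "\<dots> \<le> measure \<pi> ({t<..} \<times> {..s}) + M.C t"
    unfolding M by (intro measure_Un_le) auto
  finally show "emeasure comonotone ({t<..} \<times> {..s}) \<le> emeasure \<pi> ({t<..} \<times> {..s})"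
    by (simp add: emeasure_comonotone_quadrants \<pi>.emeasure_eq_measure)
qed

lemma comonotone_optimal:
  assumes "p \<ge> 1"
  shows "(INF \<pi>\<in>couplings M N. \<integral>\<^sup>+ (x, y). ennreal (\<bar>x - y\<bar> powr p) \<partial>\<pi>) =
    (\<integral>\<^sup>+ (x, y). ennreal (\<bar>x - y\<bar> powr p) \<partial>comonotone)"
proof (rule antisym)
  show "(INF \<pi>\<in>couplings M N. \<integral>\<^sup>+ (x, y). ennreal (\<bar>x - y\<bar> powr p) \<partial>\<pi>) \<le>
      (\<integral>\<^sup>+ (x, y). ennreal (\<bar>x - y\<bar> powr p) \<partial>comonotone)"
    by (rule INF_lower[OF comonotone_in_couplings])
  show "(\<integral>\<^sup>+ (x, y). ennreal (\<bar>x - y\<bar> powr p) \<partial>comonotone) \<le>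
      (INF \<pi>\<in>couplings M N. \<integral>\<^sup>+ (x, y). ennreal (\<bar>x - y\<bar> powr p) \<partial>\<pi>)"
  proof (rule INF_greatest)
    fix \<pi> assume \<pi>: "\<pi> \<in> couplings M N"
    then have "prob_space \<pi>" "sets \<pi> = sets borel" by (auto simp: couplings_def)
    then show "(\<integral>\<^sup>+ (x, y). ennreal (\<bar>x - y\<bar> powr p) \<partial>comonotone) \<le>
        (\<integral>\<^sup>+ (x, y). ennreal (\<bar>x - y\<bar> powr p) \<partial>\<pi>)"
      by (rule nn_integral_powr_mono[OF _ _ prob_space_comonotone sets_comonotone assms
            emeasure_comonotone_le_coupling[OF \<pi>]])
  qed
qed

section \<open>Quantile form and finiteness of the optimal cost\<close>

lemma nn_integral_comonotone_quantile:
  "(\<integral>\<^sup>+ (x, y). ennreal (\<bar>x - y\<bar> powr p) \<partial>comonotone) =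
    (\<integral>\<^sup>+ u\<in>{0..1}. ennreal_powr (e2ennreal \<bar>quantile M.C u - quantile N.C u\<bar>) p \<partial>lborel)"
proof -
  have Inf_atLeast: "Inf (ereal ` {c..}) = ereal c" for c
    by (intro antisym INF_lower INF_greatest) auto
  have quantile: "quantile M.C u = ereal (M.I u)" "quantile N.C u = ereal (N.I u)" if "0 < u" "u < 1" for u
  proof -
    \<comment> \<open>By the Galois connection the superlevel set is a closed ray, so the extended
      infimum is attained at its finite left end.\<close>
    have "{x. u \<le> M.C x} = {M.I u..}" "{x. u \<le> N.C x} = {N.I u..}"
      unfolding set_eq_iff mem_Collect_eq atLeast_iff
      using M.pseudoinverse[OF that] N.pseudoinverse[OF that] by blast+
    from this[THEN arg_cong, of "\<lambda>A. Inf (ereal ` A)"]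
    show "quantile M.C u = ereal (M.I u)" "quantile N.C u = ereal (N.I u)"
      unfolding quantile_def Inf_atLeast .
  qed
  have "(\<lambda>(x, y). ennreal (\<bar>x - y\<bar> powr p)) \<in> borel_measurable (borel :: (real \<times> real) measure)"
    unfolding borel_prod[symmetric] by measurable
  then have "(\<integral>\<^sup>+ (x, y). ennreal (\<bar>x - y\<bar> powr p) \<partial>comonotone) =
      (\<integral>\<^sup>+ u. ennreal (\<bar>M.I u - N.I u\<bar> powr p) \<partial>\<Omega>)"
    unfolding comonotone_def by (subst nn_integral_distr) auto
  also have "\<dots> = (\<integral>\<^sup>+ u\<in>{0<..<1}. ennreal (\<bar>M.I u - N.I u\<bar> powr p) \<partial>lborel)"
    by (simp add: nn_integral_restrict_space)
  \<comment> \<open>At \<open>u = 0\<close> both quantiles are \<open>-\<infinity>\<close>, and at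
    \<open>u = 1\<close> either may be \<open>\<infinity>\<close>. Whatever value the integrand
    takes there, the two endpoints are null.\<close>
  also have "\<dots> = (\<integral>\<^sup>+ u\<in>{0..1}. ennreal_powr (e2ennreal \<bar>quantile M.C u - quantile N.C u\<bar>) p \<partial>lborel)"
    using AE_lborel_singleton[of "0::real"] AE_lborel_singleton[of "1::real"]
    by (intro nn_integral_cong_AE, eventually_elim)
       (auto simp: quantile ennreal_powr_def split: split_indicator)
  finally show ?thesis .
qed

text \<open>Needed because \<open>enn2real\<close> sends \<open>\<infinity>\<close> to 0: only for a
  finite infimum does \<open>wasserstein_dist\<close> record the true cost.\<close>

lemma comonotone_cost_finite:
  assumes "p \<ge> 0" "integrable M (\<lambda>x. \<bar>x\<bar> powr p)" "integrable N (\<lambda>x. \<bar>x\<bar> powr p)"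
  shows "(\<integral>\<^sup>+ (x, y). ennreal (\<bar>x - y\<bar> powr p) \<partial>comonotone) < \<infinity>"
proof -
  have fs [measurable]: "fst \<in> borel_measurable comonotone" "snd \<in> borel_measurable comonotone"
    unfolding measurable_cong_sets[OF sets_comonotone refl] by (simp_all flip: borel_prod)
  have marginal: "distr comonotone borel fst = M" "distr comonotone borel snd = N"
    using comonotone_in_couplings by (simp_all add: couplings_def)
  \<comment> \<open>Bounding \<open>\<bar>x - y\<bar>\<close> by twice the larger of
    \<open>\<bar>x\<bar>\<close> and \<open>\<bar>y\<bar>\<close> avoids any convexity
    argument.\<close>
  have bound: "\<bar>x - y\<bar> powr p \<le> 2 powr p * (\<bar>x\<bar> powr p + \<bar>y\<bar> powr p)" for x y :: real
  proof -
    have "\<bar>x - y\<bar> powr p \<le> (2 * max \<bar>x\<bar> \<bar>y\<bar>) powr p"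
      using assms by (intro powr_mono2) auto
    also have "\<dots> \<le> 2 powr p * (\<bar>x\<bar> powr p + \<bar>y\<bar> powr p)"
      by (auto simp: powr_mult max_def)
    finally show ?thesis .
  qed
  have "(\<integral>\<^sup>+ (x, y). ennreal (\<bar>x - y\<bar> powr p) \<partial>comonotone) \<le>
      (\<integral>\<^sup>+ z. ennreal (2 powr p) * (ennreal (\<bar>fst z\<bar> powr p) + ennreal (\<bar>snd z\<bar> powr p)) \<partial>comonotone)"
    using bound by (intro nn_integral_mono) (simp add: split_beta flip: ennreal_plus ennreal_mult)
  also have "\<dots> = ennreal (2 powr p) *
      ((\<integral>\<^sup>+ z. ennreal (\<bar>fst z\<bar> powr p) \<partial>comonotone) + (\<integral>\<^sup>+ z. ennreal (\<bar>snd z\<bar> powr p) \<partial>comonotone))"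
    by (simp add: nn_integral_cmult nn_integral_add)
  also have "\<dots> = ennreal (2 powr p) *
      ((\<integral>\<^sup>+ x. ennreal (\<bar>x\<bar> powr p) \<partial>M) + (\<integral>\<^sup>+ x. ennreal (\<bar>x\<bar> powr p) \<partial>N))"
    using nn_integral_distr[OF fs(1), of "\<lambda>x. ennreal (\<bar>x\<bar> powr p)"]
      nn_integral_distr[OF fs(2), of "\<lambda>x. ennreal (\<bar>x\<bar> powr p)"]
    by (simp add: marginal)
  also have "\<dots> < \<infinity>"
    using integrableD(2)[OF assms(2)] integrableD(2)[OF assms(3)]
    by (simp add: ennreal_mult_less_top less_top)
  finally show ?thesis .
qed

end

theorem theorem2p1:
  fixes p :: real and \<mu> \<nu> :: "real measure" and F G :: "real \<Rightarrow> real"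
  assumes "p \<ge> 1"
    and "\<mu> \<in> wasserstein_space p" and "\<nu> \<in> wasserstein_space p"
    and "F = cdf \<mu>" and "G = cdf \<nu>"
  shows "ennreal (wasserstein_dist p \<mu> \<nu> powr p) =
           (\<integral>\<^sup>+ (x, y). ennreal (\<bar>x - y\<bar> powr p)
              \<partial>joint_cdf_measure (\<lambda>x y. comonotonicity_copula (F x) (G y)))
       \<and> (\<integral>\<^sup>+ (x, y). ennreal (\<bar>x - y\<bar> powr p)
              \<partial>joint_cdf_measure (\<lambda>x y. comonotonicity_copula (F x) (G y))) =
           (\<integral>\<^sup>+ u\<in>{0..1}. ennreal_powr (e2ennreal \<bar>quantile F u - quantile G u\<bar>) p \<partial>lborel)"
proof -
  have "real_distribution \<mu>" "real_distribution \<nu>"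
    and moments: "integrable \<mu> (\<lambda>x. \<bar>x\<bar> powr p)" "integrable \<nu> (\<lambda>x. \<bar>x\<bar> powr p)"
    using assms by (auto simp: wasserstein_space_def)
  then interpret cdf_distribution_pair \<mu> \<nu>
    by (simp add: cdf_distribution_pair_def cdf_distribution_def)
  have "(\<integral>\<^sup>+ (x, y). ennreal (\<bar>x - y\<bar> powr p) \<partial>comonotone) < \<infinity>"
    using assms(1) moments by (intro comonotone_cost_finite) auto
  \<comment> \<open>Finiteness lets \<open>ennreal\<close> undo \<open>enn2real\<close>, and the
    powers \<open>1 / p\<close> and \<open>p\<close> cancel.\<close>
  then have "ennreal (wasserstein_dist p \<mu> \<nu> powr p) = (\<integral>\<^sup>+ (x, y). ennreal (\<bar>x - y\<bar> powr p) \<partial>comonotone)"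
    using assms(1) by (simp add: wasserstein_dist_def comonotone_optimal powr_powr)
  then show ?thesis
    by (simp add: assms(4,5) joint_cdf_measure_comonotone nn_integral_comonotone_quantile)
qed

end
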